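(* Let $G=(V,E)$ be a simple finite graph on $m$ vertices $V=\{v_1,\ldots,v_m\}$ with degrees $d_j=\deg(v_j)$, and suppose that for some integer $d$ the graph has a unique vertex $v_r$ of degree $d$. Let $\Lambda=\Delta-\Psi$ be the zeon combinatorial Laplacian of $G$, and let $\lambda$ be the unique eigenvalue of $\Lambda$ satisfying $\mathfrak{C}\lambda=d$. Then $\Lambda$ has an eigenvector (associated with $\lambda$) of the form $x_\lambda=(\mu_1,\ldots,\mu_m)^\intercal$ where $\mu_r=1$ and $\mu_i\in\mathbb{C}\mathfrak{Z}_m^{\circ}$ for $i\neq r$. In particular, for each $\ell\neq r$, $$\langle\mu_\ell,\zeta_I\rangle=\gamma_I\,(d-d_\ell)^{-1}\prod_{j\in I\setminus\{r\}}(d-d_j)^{-1},$$ where $(-1)^{|I|}\gamma_I$ denotes the number of paths and PWICs $v_\ell\to v_r$ on vertices indexed by $I\subseteq\{1,\ldots,m\}$. Moreover, $$\lambda=d+\sum_{\{j:\{v_j,v_r\}\in E\}}\zeta_{\{j\}}\mu_j.$$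
   Context: Zeon algebra: $\mathbb{C}\mathfrak{Z}$ is the commutative unital complex algebra generated by $\zeta_{\{i\}}$, $i\in\mathbb{N}=\{1,2,\ldots\}$, and the scalar $1=\zeta_\varnothing$, with $\zeta_{\{i\}}\zeta_{\{j\}}=\zeta_{\{j\}}\zeta_{\{i\}}=\zeta_{\{i,j\}}$ for $i\neq j$ and $\zeta_{\{i\}}^2=0$. For finite $I\subset\mathbb{N}$, $\zeta_I=\prod_{i\in I}\zeta_{\{i\}}$; the $\zeta_I$ form a vector space basis. $\mathbb{C}\mathfrak{Z}_m$ is the subalgebra generated by $1,\zeta_{\{1\}},\ldots,\zeta_{\{m\}}$ and $\mathbb{C}\mathfrak{Z}_m^{\circ}$ is its ideal of nilpotent elements (those with zero scalar part). For $u=\sum_I u_I\zeta_I$, the scalar part is $\mathfrak{C}u=u_\varnothing$, and $\langle u,\zeta_I\rangle=u_I$ is the coefficient of $\zeta_I$. Eigenvalues: for $A\in\mathrm{Mat}(m,\mathbb{C}\mathfrak{Z})$ (the $m\times m$ matrices over $\mathbb{C}\mathfrak{Z}$), $\lambda\in\mathbb{C}\mathfrak{Z}$ is an eigenvalue with eigenvector $\xi$ if $A\xi=\lambda\xi$ with $\xi\in\mathbb{C}\mathfrak{Z}^m$ non-null ($\mathfrak{C}(\overline{\xi}^{\intercal}\xi)\ne 0$, where the bar is complex conjugation of coefficients; equivalently some component of $\xi$ has nonzero scalar part). Graphs: the nilpotent adjacency matrix $\Psi=(\psi_{ij})$ of $G$ has $\psi_{ij}=\zeta_{\{j\}}$ if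 $\{v_i,v_j\}\in E$ and $\psi_{ij}=0$ otherwise. $\Delta=\mathrm{diag}(d_1,\ldots,d_m)$. The zeon combinatorial Laplacian is $\Lambda=\Delta-\Psi$. Paths and PWICs: a walk from $v_\ell$ to $v_r$ is a sequence of vertices $(w_0,\ldots,w_k)$ with $w_0=v_\ell$, $w_k=v_r$ and consecutive vertices adjacent. A path is a walk with no repeated vertex. A PWIC (path with initial cycle) from $v_\ell$ to $v_r$ (distinct vertices) is a walk in which no vertex is repeated except the initial vertex $v_\ell$, which is repeated exactly once (i.e. occurs exactly twice, so the walk contains exactly one cycle, based at $v_\ell$). A path or PWIC $(w_0,\ldots,w_k)$ is on vertices indexed by $I$ when $\{w_1,\ldots,w_k\}=\{v_i:i\in I\}$, i.e. the initial occurrence $w_0$ is not included (so $\ell\notin I$ for a path and $\ell\in I$ for a PWIC).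
   Formalization: The last formula is proved with a minus sign, λ = d − Σ ζ_{j} μ_j over neighbours of v_r; the printed plus sign is false for d > 0 (path v_1–v_2–v_3, r = 2: λ = 2 + ζ_{12} + ζ_{23}, with μ_1 = μ_3 = −ζ_2). *)

theory Defs
  imports Complex_Main "Jordan_Normal_Form.Matrix"
begin

section \<open>The complex zeon algebra\<close>

text \<open>
  An element \<open>u = (\<Sum>I. u\<^sub>I \<zeta>\<^sub>I)\<close> is represented by its family of coefficients, indexed by
  the finite subsets \<open>I\<close> of \<open>{1, 2, \<dots>}\<close>.  The product is determined by
  \<open>\<zeta>\<^sub>I \<zeta>\<^sub>J = \<zeta>\<^sub>(I \<union> J)\<close> for disjoint \<open>I\<close>, \<open>J\<close> and \<open>\<zeta>\<^sub>I \<zeta>\<^sub>J = 0\<close> otherwise.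
\<close>

typedef zeon =
  "{f :: nat set \<Rightarrow> complex. finite {I. f I \<noteq> 0} \<and> (\<forall>I. f I \<noteq> 0 \<longrightarrow> finite I \<and> I \<subseteq> {1..})}"
  morphisms zcoeff Abs_zeon
  by (rule exI[of _ "\<lambda>_. 0"]) auto

setup_lifting type_definition_zeon

lemma zcoeff_finite_supp: "finite {I. zcoeff u I \<noteq> 0}"
  using zcoeff[of u] by auto

lemma zcoeff_supp: "zcoeff u I \<noteq> 0 \<Longrightarrow> finite I \<and> I \<subseteq> {1..}"
  using zcoeff[of u] by auto

lemma zeon_eqI: "(\<And>I. finite I \<Longrightarrow> zcoeff u I = zcoeff v I) \<Longrightarrow> u = v"
  by (metis ext zcoeff_inject zcoeff_supp)

lemma zeon_mult_assoc_aux: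
  fixes f g h :: "nat set \<Rightarrow> complex"
  assumes "finite K"
  shows "(\<Sum>I\<in>Pow K. (\<Sum>J\<in>Pow I. f J * g (I - J)) * h (K - I))
       = (\<Sum>J\<in>Pow K. f J * (\<Sum>L\<in>Pow (K - J). g L * h (K - J - L)))"
proof -
  have "(\<Sum>I\<in>Pow K. (\<Sum>J\<in>Pow I. f J * g (I - J)) * h (K - I))
      = (\<Sum>I\<in>Pow K. \<Sum>J\<in>Pow I. f J * g (I - J) * h (K - I))"
    by (simp add: sum_distrib_right)
  also have "\<dots> = (\<Sum>(I, J)\<in>Sigma (Pow K) Pow. f J * g (I - J) * h (K - I))"
    using assms by (intro sum.Sigma) (auto intro: finite_subset)
  also have "\<dots> = (\<Sum>(J, L)\<in>Sigma (Pow K) (\<lambda>J. Pow (K - J)). f J * g L * h (K - J - L))"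
    by (rule sum.reindex_bij_witness[of _ "\<lambda>(J, L). (J \<union> L, J)" "\<lambda>(I, J). (J, I - J)"])
       (auto intro!: arg_cong2[where f = "(*)"] arg_cong[where f = h] arg_cong[where f = g])
  also have "\<dots> = (\<Sum>J\<in>Pow K. \<Sum>L\<in>Pow (K - J). f J * g L * h (K - J - L))"
    using assms by (intro sum.Sigma[symmetric]) auto
  also have "\<dots> = (\<Sum>J\<in>Pow K. f J * (\<Sum>L\<in>Pow (K - J). g L * h (K - J - L)))"
    by (simp add: sum_distrib_left mult.assoc)
  finally show ?thesis .
qed

instantiation zeon :: comm_ring_1
begin

lift_definition zero_zeon :: zeon is "\<lambda>_. 0" by simp

lift_definition one_zeon :: zeon is "\<lambda>I. if I = {} then 1 else 0"
  by (auto split: if_splits)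

lift_definition plus_zeon :: "zeon \<Rightarrow> zeon \<Rightarrow> zeon" is "\<lambda>f g I. f I + g I"
proof -
  fix f g :: "nat set \<Rightarrow> complex"
  assume f: "finite {I. f I \<noteq> 0} \<and> (\<forall>I. f I \<noteq> 0 \<longrightarrow> finite I \<and> I \<subseteq> {1..})"
    and g: "finite {I. g I \<noteq> 0} \<and> (\<forall>I. g I \<noteq> 0 \<longrightarrow> finite I \<and> I \<subseteq> {1..})"
  have "{I. f I + g I \<noteq> 0} \<subseteq> {I. f I \<noteq> 0} \<union> {I. g I \<noteq> 0}" by auto
  then have "finite {I. f I + g I \<noteq> 0}" using f g by (meson finite_UnI finite_subset)
  then show "finite {I. f I + g I \<noteq> 0} \<and> (\<forall>I. f I + g I \<noteq> 0 \<longrightarrow> finite I \<and> I \<subseteq> {1..})"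
    using f g by (metis add_0)
qed

lift_definition uminus_zeon :: "zeon \<Rightarrow> zeon" is "\<lambda>f I. - f I" by simp

definition minus_zeon :: "zeon \<Rightarrow> zeon \<Rightarrow> zeon" where "minus_zeon u v = u + - v"

lift_definition times_zeon :: "zeon \<Rightarrow> zeon \<Rightarrow> zeon"
  is "\<lambda>f g K. if finite K then \<Sum>I\<in>Pow K. f I * g (K - I) else 0"
proof -
  fix f g :: "nat set \<Rightarrow> complex"
  assume f: "finite {I. f I \<noteq> 0} \<and> (\<forall>I. f I \<noteq> 0 \<longrightarrow> finite I \<and> I \<subseteq> {1..})"
    and g: "finite {I. g I \<noteq> 0} \<and> (\<forall>I. g I \<noteq> 0 \<longrightarrow> finite I \<and> I \<subseteq> {1..})"
  let ?h = "\<lambda>K. if finite K then \<Sum>I\<in>Pow K. f I * g (K - I) else 0"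
  have ex: "\<exists>I\<subseteq>K. f I \<noteq> 0 \<and> g (K - I) \<noteq> 0" if "?h K \<noteq> 0" for K
  proof (rule ccontr)
    assume "\<not> ?thesis"
    then have "(\<Sum>I\<in>Pow K. f I * g (K - I)) = 0" by (intro sum.neutral) auto
    with that show False by (simp split: if_splits)
  qed
  have "{K. ?h K \<noteq> 0} \<subseteq> (\<lambda>(I, J). I \<union> J) ` ({I. f I \<noteq> 0} \<times> {I. g I \<noteq> 0})"
  proof
    fix K assume "K \<in> {K. ?h K \<noteq> 0}"
    then obtain I where I: "I \<subseteq> K" "f I \<noteq> 0" "g (K - I) \<noteq> 0" using ex by blast
    then have "K = I \<union> (K - I)" by auto
    with I show "K \<in> (\<lambda>(I, J). I \<union> J) ` ({I. f I \<noteq> 0} \<times> {I. g I \<noteq> 0})"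
      by (intro image_eqI[of _ _ "(I, K - I)"]) auto
  qed
  then have "finite {K. ?h K \<noteq> 0}"
    using f g by (meson finite_SigmaI finite_imageI finite_subset)
  moreover have "finite K \<and> K \<subseteq> {1..}" if K: "?h K \<noteq> 0" for K
  proof -
    obtain I where I: "I \<subseteq> K" "f I \<noteq> 0" "g (K - I) \<noteq> 0" using ex[OF K] by blast
    then have "I \<subseteq> {1..}" "K - I \<subseteq> {1..}" using f g by blast+
    then show ?thesis using K by (auto split: if_splits)
  qed
  ultimately show "finite {K. ?h K \<noteq> 0} \<and> (\<forall>K. ?h K \<noteq> 0 \<longrightarrow> finite K \<and> K \<subseteq> {1..})"
    by blast
qed

instance
proof
  fix a b c :: zeon
  show "a * b * c = a * (b * c)"
  proof (rule zeon_eqI)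
    fix K :: "nat set" assume K: "finite K"
    have fin: "I \<subseteq> K \<Longrightarrow> finite I" for I using K finite_subset by blast
    have "zcoeff (a * b * c) K
        = (\<Sum>I\<in>Pow K. (\<Sum>J\<in>Pow I. zcoeff a J * zcoeff b (I - J)) * zcoeff c (K - I))"
      using K fin by (auto simp: times_zeon.rep_eq intro!: sum.cong)
    also have "\<dots> = (\<Sum>J\<in>Pow K. zcoeff a J *
                      (\<Sum>L\<in>Pow (K - J). zcoeff b L * zcoeff c (K - J - L)))"
      by (rule zeon_mult_assoc_aux[OF K])
    also have "\<dots> = zcoeff (a * (b * c)) K"
      using K by (simp add: times_zeon.rep_eq)
    finally show "zcoeff (a * b * c) K = zcoeff (a * (b * c)) K" .
  qed
  show "a * b = b * a"
  proof (rule zeon_eqI)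
    fix K :: "nat set" assume "finite K"
    moreover have "(\<Sum>I\<in>Pow K. zcoeff a I * zcoeff b (K - I))
                 = (\<Sum>I\<in>Pow K. zcoeff b I * zcoeff a (K - I))"
      by (rule sum.reindex_bij_witness[of _ "\<lambda>I. K - I" "\<lambda>I. K - I"])
         (auto simp: double_diff)
    ultimately show "zcoeff (a * b) K = zcoeff (b * a) K"
      by (simp add: times_zeon.rep_eq)
  qed
  show "1 * a = a"
  proof (rule zeon_eqI)
    fix K :: "nat set" assume K: "finite K"
    have "(\<Sum>I\<in>Pow K. zcoeff 1 I * zcoeff a (K - I))
        = (\<Sum>I\<in>Pow K. if I = {} then zcoeff a K else 0)"
      by (intro sum.cong) (auto simp: one_zeon.rep_eq)
    then show "zcoeff (1 * a) K = zcoeff a K"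
      using K by (simp add: times_zeon.rep_eq)
  qed
  show "(a + b) * c = a * c + b * c"
    by (rule zeon_eqI) (simp add: times_zeon.rep_eq plus_zeon.rep_eq distrib_right sum.distrib)
  show "a + b + c = a + (b + c)" by (rule zeon_eqI) (simp add: plus_zeon.rep_eq)
  show "a + b = b + a" by (rule zeon_eqI) (simp add: plus_zeon.rep_eq)
  show "0 + a = a" by (rule zeon_eqI) (simp add: plus_zeon.rep_eq zero_zeon.rep_eq)
  show "- a + a = 0"
    by (rule zeon_eqI) (simp add: plus_zeon.rep_eq zero_zeon.rep_eq uminus_zeon.rep_eq)
  show "a - b = a + - b" by (simp add: minus_zeon_def)
  show "(0 :: zeon) \<noteq> 1"
    by (metis one_zeon.rep_eq zero_neq_one zero_zeon.rep_eq)
qed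

end

lift_definition zscalar :: "complex \<Rightarrow> zeon" is "\<lambda>c I. if I = {} then c else 0"
  by (auto split: if_splits)

text \<open>For an \<open>I\<close> that is not a finite subset of \<open>{1, 2, \<dots>}\<close>, \<open>zeta I\<close> is \<open>0\<close> by convention.\<close>

lift_definition zeta :: "nat set \<Rightarrow> zeon"
  is "\<lambda>I J. if J = I \<and> finite I \<and> I \<subseteq> {1..} then 1 else 0"
  by (auto split: if_splits)

definition scalar_part :: "zeon \<Rightarrow> complex" where
  "scalar_part u = zcoeff u {}"

lemma zcoeff_sum: "zcoeff (sum f A) I = (\<Sum>a\<in>A. zcoeff (f a) I)"
  by (induction A rule: infinite_finite_induct) (simp_all add: zero_zeon.rep_eq plus_zeon.rep_eq)

lemma zcoeff_scalar_mult: "zcoeff (zscalar c * u) I = c * zcoeff u I"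
proof (cases "finite I")
  case True
  have "(\<Sum>J\<in>Pow I. zcoeff (zscalar c) J * zcoeff u (I - J))
      = (\<Sum>J\<in>Pow I. if J = {} then c * zcoeff u I else 0)"
    by (intro sum.cong) (auto simp: zscalar.rep_eq)
  with True show ?thesis by (simp add: times_zeon.rep_eq)
next
  case False
  then show ?thesis using zcoeff_supp[of u I] by (auto simp: times_zeon.rep_eq)
qed

lemma zeta_empty: "zeta {} = 1"
  by (rule zeon_eqI) (simp add: zeta.rep_eq one_zeon.rep_eq)

lemma zeta_mult: "zeta I * zeta J = (if I \<inter> J = {} then zeta (I \<union> J) else 0)"
proof (rule zeon_eqI)
  fix K :: "nat set" assume K: "finite K"
  let ?ok = "\<lambda>I. finite I \<and> I \<subseteq> {1::nat..}"
  have "zcoeff (zeta I * zeta J) K = (\<Sum>L\<in>Pow K. zcoeff (zeta I) L * zcoeff (zeta J) (K - L))"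
    using K by (simp add: times_zeon.rep_eq)
  also have "\<dots> = (\<Sum>L\<in>Pow K. if L = I then (if ?ok I \<and> ?ok J \<and> K - I = J then 1 else 0) else 0)"
    by (intro sum.cong) (auto simp: zeta.rep_eq)
  also have "\<dots> = (if I \<subseteq> K \<and> ?ok I \<and> ?ok J \<and> K - I = J then 1 else 0)"
    using K by simp
  also have "\<dots> = zcoeff (if I \<inter> J = {} then zeta (I \<union> J) else 0) K"
    by (auto simp: zeta.rep_eq zero_zeon.rep_eq)
  finally show "zcoeff (zeta I * zeta J) K = zcoeff (if I \<inter> J = {} then zeta (I \<union> J) else 0) K" .
qed

lemma zeta_prod: "finite I \<Longrightarrow> zeta I = (\<Prod>i\<in>I. zeta {i})"
proof (induction I rule: finite_induct)
  case empty
  show ?case by (simp add: zeta_empty)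
next
  case (insert x F)
  have "zeta (insert x F) = zeta {x} * zeta F"
    using insert.hyps by (simp add: zeta_mult)
  with insert show ?case by simp
qed

lemma zeon_basis_expansion:
  "u = (\<Sum>I | zcoeff u I \<noteq> 0. zscalar (zcoeff u I) * zeta I)"
proof (rule zeon_eqI)
  fix K :: "nat set"
  have "(\<Sum>I | zcoeff u I \<noteq> 0. zcoeff u I * zcoeff (zeta I) K)
      = (\<Sum>I | zcoeff u I \<noteq> 0. if I = K then zcoeff u K else 0)"
    using zcoeff_supp by (intro sum.cong) (auto simp: zeta.rep_eq)
  also have "\<dots> = zcoeff u K" by (simp add: zcoeff_finite_supp)
  finally show "zcoeff u K = zcoeff (\<Sum>I | zcoeff u I \<noteq> 0. zscalar (zcoeff u I) * zeta I) K"
    by (simp add: zcoeff_sum zcoeff_scalar_mult)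
qed

instantiation zeon :: conjugatable_ring
begin

lift_definition conjugate_zeon :: "zeon \<Rightarrow> zeon" is "\<lambda>f I. cnj (f I)" by simp

instance
proof
  fix a b :: zeon
  have conj: "conjugate (conjugate u) = u" for u :: zeon
    by (rule zeon_eqI) (simp add: conjugate_zeon.rep_eq)
  show "conjugate (conjugate a) = a" by (rule conj)
  show "conjugate (a + b) = conjugate a + conjugate b"
    by (rule zeon_eqI) (simp add: conjugate_zeon.rep_eq plus_zeon.rep_eq)
  show "conjugate (a * b) = conjugate a * conjugate b"
    by (rule zeon_eqI) (simp add: conjugate_zeon.rep_eq times_zeon.rep_eq)
  show "conjugate (- a) = - conjugate a"
    by (rule zeon_eqI) (simp add: conjugate_zeon.rep_eq uminus_zeon.rep_eq)
  show "conjugate (0 :: zeon) = 0"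
    by (rule zeon_eqI) (simp add: conjugate_zeon.rep_eq zero_zeon.rep_eq)
  show "conjugate a = conjugate b \<longleftrightarrow> a = b"
    by (metis conj)
qed

end

inductive_set zeon_subalgebra :: "nat \<Rightarrow> zeon set" for m :: nat where
  scalar: "zscalar c \<in> zeon_subalgebra m"
| generator: "i \<in> {1..m} \<Longrightarrow> zeta {i} \<in> zeon_subalgebra m"
| add: "u \<in> zeon_subalgebra m \<Longrightarrow> v \<in> zeon_subalgebra m \<Longrightarrow> u + v \<in> zeon_subalgebra m"
| mult: "u \<in> zeon_subalgebra m \<Longrightarrow> v \<in> zeon_subalgebra m \<Longrightarrow> u * v \<in> zeon_subalgebra m"

definition zeon_nilpotents :: "nat \<Rightarrow> zeon set" where
  "zeon_nilpotents m = {u \<in> zeon_subalgebra m. \<exists>k. u ^ k = 0}"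

lemma zcoeff_mult_nonzeroE:
  assumes "zcoeff (u * v) K \<noteq> 0"
  obtains I where "finite K" "I \<subseteq> K" "zcoeff u I \<noteq> 0" "zcoeff v (K - I) \<noteq> 0"
proof -
  have "finite K" and nz: "(\<Sum>I\<in>Pow K. zcoeff u I * zcoeff v (K - I)) \<noteq> 0"
    using assms by (auto simp: times_zeon.rep_eq split: if_splits)
  from sum.not_neutral_contains_not_neutral[OF nz] obtain I
    where "I \<subseteq> K" "zcoeff u I \<noteq> 0" "zcoeff v (K - I) \<noteq> 0" by auto
  with \<open>finite K\<close> show thesis by (rule that)
qed

lemma zeon_subalgebra_supp:
  "u \<in> zeon_subalgebra m \<Longrightarrow> zcoeff u I \<noteq> 0 \<Longrightarrow> I \<subseteq> {1..m}"
proof (induction arbitrary: I rule: zeon_subalgebra.induct)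
  case (mult u v)
  from mult.prems obtain J where "J \<subseteq> I" "zcoeff u J \<noteq> 0" "zcoeff v (I - J) \<noteq> 0"
    by (rule zcoeff_mult_nonzeroE)
  with mult.IH have "J \<subseteq> {1..m}" "I - J \<subseteq> {1..m}" by blast+
  then show ?case by blast
next
  case (add u v)
  then show ?case by (metis add_0 plus_zeon.rep_eq)
qed (auto simp: zscalar.rep_eq zeta.rep_eq split: if_splits)

lemma scalar_part_power: "scalar_part (u ^ k) = scalar_part u ^ k"
  by (induction k) (simp_all add: scalar_part_def one_zeon.rep_eq times_zeon.rep_eq)

lemma zcoeff_power_nonzero:
  assumes "scalar_part u = 0"
  shows "zcoeff (u ^ k) I \<noteq> 0 \<Longrightarrow> k \<le> card I"
proof (induction k arbitrary: I)
  case (Suc k)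
  from Suc.prems obtain J where J: "finite I" "J \<subseteq> I" "zcoeff u J \<noteq> 0" "zcoeff (u ^ k) (I - J) \<noteq> 0"
    unfolding power_Suc by (rule zcoeff_mult_nonzeroE)
  then have "J \<noteq> {}" using assms by (auto simp: scalar_part_def)
  then have "I - J \<subset> I" using J by auto
  then have "card (I - J) < card I" using J by (intro psubset_card_mono)
  with Suc.IH[OF J(4)] show ?case by simp
qed simp

lemma zeon_nilpotents_eq: "zeon_nilpotents m = {u \<in> zeon_subalgebra m. scalar_part u = 0}"
proof -
  have "scalar_part u = 0" if "u ^ k = 0" for u :: zeon and k
  proof -
    have "scalar_part u ^ k = 0"
      using that scalar_part_power[of u k] by (simp add: scalar_part_def zero_zeon.rep_eq)
    then show ?thesis by simp
  qed
  moreover have "u ^ Suc m = 0" if u: "u \<in> zeon_subalgebra m" "scalar_part u = 0" for u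
  proof (rule ccontr)
    assume "u ^ Suc m \<noteq> 0"
    then obtain I where I: "zcoeff (u ^ Suc m) I \<noteq> 0"
      by (metis zeon_eqI zero_zeon.rep_eq)
    have one: "1 \<in> zeon_subalgebra m"
    proof -
      have "zscalar 1 = 1" by (rule zeon_eqI) (simp add: zscalar.rep_eq one_zeon.rep_eq)
      then show ?thesis by (metis zeon_subalgebra.scalar)
    qed
    have "u ^ k \<in> zeon_subalgebra m" for k
      by (induction k) (simp_all add: one u zeon_subalgebra.mult)
    then have "I \<subseteq> {1..m}" using I zeon_subalgebra_supp by blast
    then have "card I \<le> m" using card_mono[of "{1..m}" I] by simp
    then show False using zcoeff_power_nonzero[OF u(2) I] by simp
  qed
  ultimately show ?thesis unfolding zeon_nilpotents_def by blast
qed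


section \<open>Zeon eigenvalues\<close>

definition zeon_eigenvector :: "zeon mat \<Rightarrow> zeon vec \<Rightarrow> zeon \<Rightarrow> bool" where
  "zeon_eigenvector A \<xi> lam \<longleftrightarrow>
     \<xi> \<in> carrier_vec (dim_row A) \<and>
     scalar_part (conjugate \<xi> \<bullet> \<xi>) \<noteq> 0 \<and>
     A *\<^sub>v \<xi> = lam \<cdot>\<^sub>v \<xi>"

definition zeon_eigenvalue :: "zeon mat \<Rightarrow> zeon \<Rightarrow> bool" where
  "zeon_eigenvalue A lam \<longleftrightarrow> (\<exists>\<xi>. zeon_eigenvector A \<xi> lam)"


section \<open>Graphs, paths and the zeon combinatorial Laplacian\<close>

definition simple_graph :: "'a set \<Rightarrow> 'a set set \<Rightarrow> bool" where
  "simple_graph V E \<longleftrightarrow> finite V \<and> (\<forall>e\<in>E. e \<subseteq> V \<and> card e = 2)"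

definition vdegree :: "'a set set \<Rightarrow> 'a \<Rightarrow> nat" where
  "vdegree E x = card {e \<in> E. x \<in> e}"

text \<open>
  A graph on \<open>m\<close> vertices comes with an enumeration \<open>v 1, \<dots>, v m\<close> of its vertices, while
  the rows and columns of matrices are numbered from \<open>0\<close>; hence the shift by one below.
\<close>

definition nilpotent_adjacency :: "nat \<Rightarrow> (nat \<Rightarrow> 'a) \<Rightarrow> 'a set set \<Rightarrow> zeon mat" where
  "nilpotent_adjacency m v E =
     mat m m (\<lambda>(i, j). if {v (Suc i), v (Suc j)} \<in> E then zeta {Suc j} else 0)"

definition degree_matrix :: "nat \<Rightarrow> (nat \<Rightarrow> 'a) \<Rightarrow> 'a set set \<Rightarrow> zeon mat" where
  "degree_matrix m v E = mat_diag m (\<lambda>i. of_nat (vdegree E (v (Suc i))))"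

definition zeon_laplacian :: "nat \<Rightarrow> (nat \<Rightarrow> 'a) \<Rightarrow> 'a set set \<Rightarrow> zeon mat" where
  "zeon_laplacian m v E = degree_matrix m v E - nilpotent_adjacency m v E"

definition is_walk :: "'a set \<Rightarrow> 'a set set \<Rightarrow> 'a \<Rightarrow> 'a \<Rightarrow> 'a list \<Rightarrow> bool" where
  "is_walk V E a b w \<longleftrightarrow>
     w \<noteq> [] \<and> set w \<subseteq> V \<and> hd w = a \<and> last w = b \<and>
     (\<forall>i. Suc i < length w \<longrightarrow> {w ! i, w ! Suc i} \<in> E)"

definition is_path :: "'a set \<Rightarrow> 'a set set \<Rightarrow> 'a \<Rightarrow> 'a \<Rightarrow> 'a list \<Rightarrow> bool" where
  "is_path V E a b w \<longleftrightarrow> is_walk V E a b w \<and> distinct w"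

definition is_pwic :: "'a set \<Rightarrow> 'a set set \<Rightarrow> 'a \<Rightarrow> 'a \<Rightarrow> 'a list \<Rightarrow> bool" where
  "is_pwic V E a b w \<longleftrightarrow>
     a \<noteq> b \<and> is_walk V E a b w \<and> count_list w a = 2 \<and> (\<forall>x. x \<noteq> a \<longrightarrow> count_list w x \<le> 1)"

definition paths_pwics_on ::
  "'a set \<Rightarrow> 'a set set \<Rightarrow> (nat \<Rightarrow> 'a) \<Rightarrow> nat \<Rightarrow> nat \<Rightarrow> nat set \<Rightarrow> 'a list set" where
  "paths_pwics_on V E v l r I =
     {w. (is_path V E (v l) (v r) w \<or> is_pwic V E (v l) (v r) w) \<and> set (tl w) = v ` I}"

text \<open>The number \<open>\<gamma>\<^sub>I\<close> with \<open>(-1)^|I| \<gamma>\<^sub>I = card (paths_pwics_on V E v l r I)\<close>.\<close>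

definition path_pwic_gamma ::
  "'a set \<Rightarrow> 'a set set \<Rightarrow> (nat \<Rightarrow> 'a) \<Rightarrow> nat \<Rightarrow> nat \<Rightarrow> nat set \<Rightarrow> complex" where
  "path_pwic_gamma V E v l r I = (-1) ^ card I * of_nat (card (paths_pwics_on V E v l r I))"

end

theory Submission
  imports Defs
begin

text \<open>
  For \<open>l \<noteq> r\<close> every coefficient of \<open>\<mu>\<^sub>l\<close> counts walks that end in \<open>v\<^sub>r\<close>, so \<open>\<zeta>\<^sub>r\<close> divides \<open>\<mu>\<^sub>l\<close>
  and \<open>N = \<Sum> \<zeta>\<^sub>j \<mu>\<^sub>j\<close> (the sum over the neighbours \<open>v\<^sub>j\<close> of \<open>v\<^sub>r\<close>), whence \<open>N \<mu>\<^sub>l = 0\<close>.  Row \<open>l\<close> of the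
  eigenvalue equation for \<open>\<lambda> = d - N\<close> therefore reduces to the linear recursion
  \<open>(d - d\<^sub>l) \<mu>\<^sub>l = - \<Sum> \<zeta>\<^sub>j \<mu>\<^sub>j\<close> over the neighbours \<open>v\<^sub>j\<close> of \<open>v\<^sub>l\<close>.  Since the \<open>\<zeta>\<^sub>j\<close> square to zero, it is
  solved by the signed, weighted walks \<open>(w\<^sub>0, \<dots>, w\<^sub>k)\<close> from \<open>v\<^sub>l\<close> to \<open>v\<^sub>r\<close> with distinct
  \<open>w\<^sub>1, \<dots>, w\<^sub>k\<close>, and these are exactly the paths and the PWICs.

  For the uniqueness of \<open>\<lambda>\<close>, let \<open>(\<lambda>, x)\<close> and \<open>(\<lambda>', y)\<close> be two eigenpairs with scalar part \<open>d\<close>.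
  The scalar part of the matrix forces \<open>x\<^sub>r\<close> and \<open>y\<^sub>r\<close> to be units.  The entries of
  \<open>D = x\<^sub>r y - y\<^sub>r x\<close> then vanish to every order, by induction on the size of the index
  sets, and row \<open>r\<close> gives \<open>(\<lambda>' - \<lambda>) x\<^sub>r y\<^sub>r = 0\<close>.
\<close>

section \<open>Coefficients of zeon elements\<close>

lemma zcoeff_zero [simp]: "zcoeff 0 I = 0"
  by (simp add: zero_zeon.rep_eq)

lemma zcoeff_add [simp]: "zcoeff (u + w) I = zcoeff u I + zcoeff w I"
  by (simp add: plus_zeon.rep_eq)

lemma zcoeff_uminus [simp]: "zcoeff (- u) I = - zcoeff u I"
  by (simp add: uminus_zeon.rep_eq)

lemma zcoeff_diff [simp]: "zcoeff (u - w) I = zcoeff u I - zcoeff w I"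
  using zcoeff_add[of u "- w" I] by simp

lemma zcoeff_of_int: "zcoeff (of_int k) I = (if I = {} then of_int k else 0)"
proof -
  have nat: "zcoeff (of_nat n) I = (if I = {} then of_nat n else 0)" for n
    by (induction n) (auto simp: one_zeon.rep_eq)
  show ?thesis
    by (cases k rule: int_cases2) (simp_all add: nat)
qed

lemma zscalar_of_int: "zscalar (of_int k) = of_int k"
  by (rule zeon_eqI) (simp add: zscalar.rep_eq zcoeff_of_int)

lemma zcoeff_of_int_mult: "zcoeff (of_int k * u) I = of_int k * zcoeff u I"
  by (metis zcoeff_scalar_mult zscalar_of_int)

lemma zcoeff_of_nat_mult: "zcoeff (of_nat n * u) I = of_nat n * zcoeff u I"
  using zcoeff_of_int_mult[of "int n"] by simp

lemma scalar_part_simps [simp]: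
  "scalar_part 0 = 0" "scalar_part 1 = 1"
  "scalar_part (u + w) = scalar_part u + scalar_part w"
  "scalar_part (u - w) = scalar_part u - scalar_part w"
  "scalar_part (- u) = - scalar_part u"
  "scalar_part (u * w) = scalar_part u * scalar_part w"
  "scalar_part (conjugate u) = cnj (scalar_part u)"
  by (simp_all add: scalar_part_def one_zeon.rep_eq times_zeon.rep_eq conjugate_zeon.rep_eq)

lemma scalar_part_sum: "scalar_part (sum f A) = (\<Sum>a\<in>A. scalar_part (f a))"
  by (simp add: scalar_part_def zcoeff_sum)

lemma scalar_part_of_int [simp]: "scalar_part (of_int k) = of_int k"
  using zcoeff_of_int_mult[of k 1] by (simp add: scalar_part_def one_zeon.rep_eq)

lemma scalar_part_of_nat [simp]: "scalar_part (of_nat n) = of_nat n"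
  using scalar_part_of_int[of "int n"] by simp

lemma scalar_part_zeta_singleton [simp]: "scalar_part (zeta {j}) = 0"
  by (simp add: scalar_part_def zeta.rep_eq)

text \<open>Only the factorisation of \<open>I\<close> into \<open>{j}\<close> and
  \<open>I - {j}\<close> contributes. The case \<open>j = 0\<close> is excluded because
  \<open>zeta {0}\<close> is \<open>0\<close> by convention.\<close>

lemma zcoeff_zeta_singleton_mult:
  assumes "j \<ge> 1" "finite I"
  shows "zcoeff (zeta {j} * u) I = (if j \<in> I then zcoeff u (I - {j}) else 0)"
proof -
  have "zcoeff (zeta {j} * u) I = (\<Sum>J\<in>Pow I. zcoeff (zeta {j}) J * zcoeff u (I - J))"
    using assms by (simp add: times_zeon.rep_eq)
  also have "\<dots> = (\<Sum>J\<in>Pow I. if J = {j} then zcoeff u (I - {j}) else 0)"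
    using assms by (intro sum.cong) (auto simp: zeta.rep_eq)
  finally show ?thesis
    using assms by simp
qed

text \<open>Allows an element to be defined by prescribed coefficients.\<close>

lemma zcoeff_sum_zeta:
  assumes "finite S" "S \<subseteq> {1..}"
  shows "zcoeff (\<Sum>I\<in>Pow S. zscalar (c I) * zeta I) K = (if K \<subseteq> S then c K else 0)"
proof -
  have "zcoeff (\<Sum>I\<in>Pow S. zscalar (c I) * zeta I) K = (\<Sum>I\<in>Pow S. if I = K then c K else 0)"
    unfolding zcoeff_sum zcoeff_scalar_mult
    using assms finite_subset[OF _ assms(1)] by (intro sum.cong) (auto simp: zeta.rep_eq)
  then show ?thesis
    using assms(1) by simp
qed

lemma one_in_zeon_subalgebra: "1 \<in> zeon_subalgebra m"
  using zeon_subalgebra.scalar[of 1 m] zscalar_of_int[of 1] by simp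

lemma zeta_in_zeon_subalgebra:
  assumes "I \<subseteq> {1..m}"
  shows "zeta I \<in> zeon_subalgebra m"
proof -
  have "finite I" using assms finite_subset by blast
  then have "(\<Prod>i\<in>I. zeta {i}) \<in> zeon_subalgebra m"
    using assms
    by (induction I rule: finite_induct)
       (simp_all add: one_in_zeon_subalgebra zeon_subalgebra.mult zeon_subalgebra.generator)
  then show ?thesis using \<open>finite I\<close> by (simp flip: zeta_prod)
qed

lemma sum_in_zeon_subalgebra:
  assumes "\<And>a. a \<in> A \<Longrightarrow> f a \<in> zeon_subalgebra m"
  shows "sum f A \<in> zeon_subalgebra m"
proof -
  have "0 \<in> zeon_subalgebra m"
    using zeon_subalgebra.scalar[of 0 m] zscalar_of_int[of 0] by simp
  then show ?thesis
    using assms by (induction A rule: infinite_finite_induct) (auto intro: zeon_subalgebra.intros)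
qed

text \<open>Both factors are multiples of \<open>zeta {r}\<close>, whose square is zero.\<close>

lemma zeon_mult_eq_0I:
  assumes u: "\<And>I. zcoeff u I \<noteq> 0 \<Longrightarrow> r \<in> I" and w: "\<And>I. zcoeff w I \<noteq> 0 \<Longrightarrow> r \<in> I"
  shows "u * w = 0"
proof (rule zeon_eqI, rule ccontr)
  fix K assume "zcoeff (u * w) K \<noteq> zcoeff 0 K"
  then have "zcoeff (u * w) K \<noteq> 0" by simp
  then obtain I where "zcoeff u I \<noteq> 0" "zcoeff w (K - I) \<noteq> 0"
    by (rule zcoeff_mult_nonzeroE)
  then show False using u w by blast
qed

section \<open>The order filtration\<close>

text \<open>This is the \<open>n\<close>-th power of the ideal of elements with zero scalar
  part.\<close>

definition zeon_order_ge :: "nat \<Rightarrow> zeon set" where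
  "zeon_order_ge n = {u. \<forall>I. zcoeff u I \<noteq> 0 \<longrightarrow> n \<le> card I}"

lemma zeon_order_ge_0: "u \<in> zeon_order_ge 0"
  by (simp add: zeon_order_ge_def)

lemma zero_in_zeon_order_ge: "0 \<in> zeon_order_ge n"
  by (simp add: zeon_order_ge_def)

lemma zeon_order_ge_add:
  "u \<in> zeon_order_ge n \<Longrightarrow> w \<in> zeon_order_ge n \<Longrightarrow> u + w \<in> zeon_order_ge n"
  by (simp add: zeon_order_ge_def) (metis add_0)

lemma zeon_order_ge_diff:
  "u \<in> zeon_order_ge n \<Longrightarrow> w \<in> zeon_order_ge n \<Longrightarrow> u - w \<in> zeon_order_ge n"
  using zeon_order_ge_add[of u n "- w"] by (simp add: zeon_order_ge_def)

lemma zeon_order_ge_sum: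
  "(\<And>a. a \<in> A \<Longrightarrow> f a \<in> zeon_order_ge n) \<Longrightarrow> sum f A \<in> zeon_order_ge n"
  by (induction A rule: infinite_finite_induct)
     (auto intro: zeon_order_ge_add zero_in_zeon_order_ge)

lemma zeon_order_ge_mult:
  assumes "u \<in> zeon_order_ge n"
  shows "w * u \<in> zeon_order_ge n"
  unfolding zeon_order_ge_def
proof (intro CollectI allI impI)
  fix K assume "zcoeff (w * u) K \<noteq> 0"
  then obtain J where J: "finite K" "J \<subseteq> K" "zcoeff w J \<noteq> 0" "zcoeff u (K - J) \<noteq> 0"
    by (rule zcoeff_mult_nonzeroE)
  then have "n \<le> card (K - J)" using assms by (auto simp: zeon_order_ge_def)
  also have "\<dots> \<le> card K" using J by (intro card_mono) auto
  finally show "n \<le> card K" .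
qed

text \<open>Every term of \<open>w\<close> has a nonempty index set, so it contributes at least one
  further generator.\<close>

lemma zeon_order_ge_nilpotent_mult:
  assumes "u \<in> zeon_order_ge n" "scalar_part w = 0"
  shows "w * u \<in> zeon_order_ge (Suc n)"
  unfolding zeon_order_ge_def
proof (intro CollectI allI impI)
  fix K assume "zcoeff (w * u) K \<noteq> 0"
  then obtain J where J: "finite K" "J \<subseteq> K" "zcoeff w J \<noteq> 0" "zcoeff u (K - J) \<noteq> 0"
    by (rule zcoeff_mult_nonzeroE)
  then have "J \<noteq> {}" using assms by (auto simp: scalar_part_def)
  have "n \<le> card (K - J)" using assms J by (auto simp: zeon_order_ge_def)
  also have "\<dots> < card K" using J \<open>J \<noteq> {}\<close> by (intro psubset_card_mono) auto
  finally show "Suc n \<le> card K" by simp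
qed

text \<open>Split \<open>a\<close> into its scalar part \<open>s\<close> and a nilpotent rest. The
  rest raises the order of \<open>u\<close> by one, so \<open>zscalar s * u\<close> has the higher
  order as well, and \<open>s\<close> can be divided out coefficientwise.\<close>

lemma zeon_order_ge_cancel:
  assumes u: "u \<in> zeon_order_ge n" and a: "scalar_part a \<noteq> 0"
    and au: "a * u \<in> zeon_order_ge (Suc n)"
  shows "u \<in> zeon_order_ge (Suc n)"
proof -
  define s where "s = scalar_part a"
  have "scalar_part (a - zscalar s) = 0"
    by (simp add: s_def) (simp add: scalar_part_def zscalar.rep_eq)
  then have "(a - zscalar s) * u \<in> zeon_order_ge (Suc n)"
    using u by (rule zeon_order_ge_nilpotent_mult[rotated])
  with au have "a * u - (a - zscalar s) * u \<in> zeon_order_ge (Suc n)"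
    by (rule zeon_order_ge_diff)
  then have "zscalar s * u \<in> zeon_order_ge (Suc n)"
    by (simp add: algebra_simps)
  then show ?thesis
    using a by (simp add: zeon_order_ge_def zcoeff_scalar_mult s_def)
qed

lemma zeon_order_ge_all:
  assumes "\<And>n. u \<in> zeon_order_ge n"
  shows "u = 0"
proof (rule zeon_eqI, rule ccontr)
  fix K assume "zcoeff u K \<noteq> zcoeff 0 K"
  with assms[of "Suc (card K)"] show False by (auto simp: zeon_order_ge_def)
qed

text \<open>Here \<open>a\<close> is a unit. Rather than inverting it, the proof lifts
  \<open>u\<close> through all steps of the filtration.\<close>

lemma zeon_mult_eq_0_cancel:
  assumes "a * u = 0" "scalar_part a \<noteq> 0"
  shows "u = 0"
proof (rule zeon_order_ge_all)
  show "u \<in> zeon_order_ge n" for n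
  proof (induction n)
    case (Suc n)
    with assms show ?case by (metis zeon_order_ge_cancel zero_in_zeon_order_ge)
  qed (rule zeon_order_ge_0)
qed

section \<open>Uniqueness of the eigenvalue\<close>

text \<open>The scalar part is the sum of the squared moduli of the scalar parts of the
  entries.\<close>

lemma scalar_part_conjugate_scalar_prod:
  "scalar_part (conjugate \<xi> \<bullet> \<xi>) \<noteq> 0 \<longleftrightarrow> (\<exists>i<dim_vec \<xi>. scalar_part (\<xi> $ i) \<noteq> 0)"
proof -
  have "scalar_part (conjugate \<xi> \<bullet> \<xi>) = (\<Sum>i<dim_vec \<xi>. cnj (scalar_part (\<xi> $ i)) * scalar_part (\<xi> $ i))"
    by (simp add: scalar_prod_def scalar_part_sum atLeast0LessThan)
  also have "\<dots> = of_real (\<Sum>i<dim_vec \<xi>. (cmod (scalar_part (\<xi> $ i)))\<^sup>2)"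
    by (simp add: complex_norm_square mult.commute del: of_real_power)
  finally show ?thesis
    by (auto simp: sum_nonneg_eq_0_iff simp del: of_real_sum)
qed

lemma eigenvector_row:
  assumes "zeon_eigenvector A \<xi> lam" "A \<in> carrier_mat m m" "l < m"
  shows "(\<Sum>j<m. A $$ (l, j) * \<xi> $ j) = lam * \<xi> $ l"
proof -
  from assms have "\<xi> \<in> carrier_vec m" "(A *\<^sub>v \<xi>) $ l = (lam \<cdot>\<^sub>v \<xi>) $ l"
    by (auto simp: zeon_eigenvector_def)
  then show ?thesis
    using assms by (simp add: scalar_prod_def atLeast0LessThan)
qed

text \<open>Taking scalar parts turns \<open>A\<close> into a diagonal complex matrix. Entries of
  the eigenvector at positions with a different diagonal value then have scalar part zero, and being
  non-null leaves only position \<open>k\<close>.\<close>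

lemma eigenvector_scalar_part:
  assumes ev: "zeon_eigenvector A \<xi> lam" and A: "A \<in> carrier_mat m m"
    and off: "\<And>i j. i < m \<Longrightarrow> j < m \<Longrightarrow> i \<noteq> j \<Longrightarrow> scalar_part (A $$ (i, j)) = 0"
    and diag: "\<And>l. l < m \<Longrightarrow> l \<noteq> k \<Longrightarrow> scalar_part (A $$ (l, l)) \<noteq> scalar_part lam"
  shows "scalar_part (\<xi> $ k) \<noteq> 0"
proof -
  have "scalar_part (\<xi> $ l) = 0" if l: "l < m" "l \<noteq> k" for l
  proof -
    have "scalar_part lam * scalar_part (\<xi> $ l) = (\<Sum>j<m. scalar_part (A $$ (l, j)) * scalar_part (\<xi> $ j))"
      using arg_cong[OF eigenvector_row[OF ev A l(1)], of scalar_part] by (simp add: scalar_part_sum)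
    also have "\<dots> = (\<Sum>j<m. if j = l then scalar_part (A $$ (l, l)) * scalar_part (\<xi> $ l) else 0)"
      using off l by (intro sum.cong) auto
    also have "\<dots> = scalar_part (A $$ (l, l)) * scalar_part (\<xi> $ l)"
      using l by simp
    finally show ?thesis using diag[OF l] by simp
  qed
  moreover have "\<exists>i<m. scalar_part (\<xi> $ i) \<noteq> 0"
    using ev A by (auto simp: zeon_eigenvector_def scalar_part_conjugate_scalar_prod)
  ultimately show ?thesis by blast
qed

theorem zeon_eigenvalue_unique:
  assumes A: "A \<in> carrier_mat m m" and k: "k < m"
    and off: "\<And>i j. i < m \<Longrightarrow> j < m \<Longrightarrow> i \<noteq> j \<Longrightarrow> scalar_part (A $$ (i, j)) = 0"
    and diag: "\<And>l. l < m \<Longrightarrow> l \<noteq> k \<Longrightarrow> scalar_part (A $$ (l, l)) \<noteq> s"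
    and ev: "zeon_eigenvalue A lam" "zeon_eigenvalue A lam'"
    and s: "scalar_part lam = s" "scalar_part lam' = s"
  shows "lam = lam'"
proof -
  obtain x y where x: "zeon_eigenvector A x lam" and y: "zeon_eigenvector A y lam'"
    using ev by (auto simp: zeon_eigenvalue_def)
  have xk: "scalar_part (x $ k) \<noteq> 0"
    by (rule eigenvector_scalar_part[OF x A]) (simp_all add: off diag s)
  have yk: "scalar_part (y $ k) \<noteq> 0"
    by (rule eigenvector_scalar_part[OF y A]) (simp_all add: off diag s)
  \<comment> \<open>\<open>D\<close> measures how far \<open>y\<close> is from being proportional to
    \<open>x\<close>; the units \<open>x $ k\<close> and \<open>y $ k\<close> normalise both vectors
    without division.\<close>
  define D where "D j = x $ k * y $ j - y $ k * x $ j" for j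
  have Dk: "D k = 0" by (simp add: D_def)
  \<comment> \<open>The last term is the defect caused by the two eigenvalues being possibly
    different.\<close>
  have row: "(\<Sum>j<m. A $$ (l, j) * D j) = lam' * D l + (lam' - lam) * y $ k * x $ l"
    if "l < m" for l
  proof -
    have "(\<Sum>j<m. A $$ (l, j) * D j) =
        x $ k * (\<Sum>j<m. A $$ (l, j) * y $ j) - y $ k * (\<Sum>j<m. A $$ (l, j) * x $ j)"
      by (simp add: D_def sum_distrib_left right_diff_distrib sum_subtractf mult_ac)
    then show ?thesis
      unfolding eigenvector_row[OF x A that] eigenvector_row[OF y A that]
      by (simp add: D_def algebra_simps)
  qed
  have rowk: "(\<Sum>j<m. A $$ (k, j) * D j) = (lam' - lam) * y $ k * x $ k"
    using row[OF k] by (simp add: Dk)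
  have "D l \<in> zeon_order_ge n" if "l < m" for l n
    using that
  proof (induction n arbitrary: l)
    case (Suc n)
    show ?case
    proof (cases "l = k")
      case False
      let ?S = "\<Sum>j\<in>{..<m} - {l}. A $$ (l, j) * D j" and ?T = "\<Sum>j<m. A $$ (k, j) * D j"
      have S: "?S \<in> zeon_order_ge (Suc n)"
        by (intro zeon_order_ge_sum zeon_order_ge_nilpotent_mult Suc.IH off Suc.prems) auto
      \<comment> \<open>The diagonal entry of row \<open>k\<close> need not be nilpotent, but it
        meets \<open>D k = 0\<close>.\<close>
      have "A $$ (k, j) * D j \<in> zeon_order_ge (Suc n)" if "j < m" for j
        using zeon_order_ge_nilpotent_mult[OF Suc.IH[OF that] off[OF k that]]
        by (cases "j = k") (simp_all add: Dk zero_in_zeon_order_ge)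
      then have T: "?T \<in> zeon_order_ge (Suc n)"
        by (intro zeon_order_ge_sum) auto
      have split: "A $$ (l, l) * D l + ?S = lam' * D l + (lam' - lam) * y $ k * x $ l"
        unfolding row[OF Suc.prems, symmetric]
        using Suc.prems by (intro sum.remove[symmetric]) auto
      \<comment> \<open>After multiplication by \<open>x $ k\<close> the defect in row
        \<open>l\<close> becomes \<open>x $ l\<close> times the defect in row \<open>k\<close>,
        which is \<open>?T\<close>. This eliminates the unknown difference
        \<open>lam' - lam\<close>.\<close>
      have "x $ k * (A $$ (l, l) * D l + ?S) = x $ k * (lam' * D l) + x $ l * ?T"
        unfolding split rowk by (simp add: algebra_simps)
      then have "(x $ k * (A $$ (l, l) - lam')) * D l = x $ l * ?T - x $ k * ?S"
        by (simp add: algebra_simps)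
      moreover have "x $ l * ?T - x $ k * ?S \<in> zeon_order_ge (Suc n)"
        using S T by (intro zeon_order_ge_diff zeon_order_ge_mult)
      ultimately have "(x $ k * (A $$ (l, l) - lam')) * D l \<in> zeon_order_ge (Suc n)"
        by simp
      moreover have "scalar_part (x $ k * (A $$ (l, l) - lam')) \<noteq> 0"
        using xk diag[OF Suc.prems False] s by simp
      ultimately show ?thesis
        using zeon_order_ge_cancel[OF Suc.IH[OF Suc.prems]] by blast
    qed (simp add: Dk zero_in_zeon_order_ge)
  qed (rule zeon_order_ge_0)
  then have "D l = 0" if "l < m" for l
    using that by (intro zeon_order_ge_all)
  then have "(\<Sum>j<m. A $$ (k, j) * D j) = 0"
    by (intro sum.neutral) simp
  then have "(y $ k * x $ k) * (lam' - lam) = 0"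
    unfolding rowk by (simp add: mult_ac)
  moreover have "scalar_part (y $ k * x $ k) \<noteq> 0"
    using xk yk by simp
  ultimately have "lam' - lam = 0"
    by (rule zeon_mult_eq_0_cancel)
  then show ?thesis by simp
qed

section \<open>First-step decomposition of paths and PWICs\<close>

lemma is_walk_Cons_Cons:
  "is_walk V E a b (x # y # ys) \<longleftrightarrow> x = a \<and> a \<in> V \<and> {a, y} \<in> E \<and> is_walk V E y b (y # ys)"
proof -
  have "(\<forall>i. Suc i < length (x # y # ys) \<longrightarrow> {(x # y # ys) ! i, (x # y # ys) ! Suc i} \<in> E) \<longleftrightarrow>
      {x, y} \<in> E \<and> (\<forall>i. Suc i < length (y # ys) \<longrightarrow> {(y # ys) ! i, (y # ys) ! Suc i} \<in> E)"
    (is "?L \<longleftrightarrow> ?R")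
  proof
    assume ?L
    then show ?R by (auto dest: spec[of _ 0] spec[of _ "Suc _"])
  next
    assume R: ?R
    show ?L
    proof (intro allI impI)
      fix i assume "Suc i < length (x # y # ys)"
      with R show "{(x # y # ys) ! i, (x # y # ys) ! Suc i} \<in> E" by (cases i) auto
    qed
  qed
  then show ?thesis
    unfolding is_walk_def by auto
qed

lemma distinct_iff_count_list: "distinct xs \<longleftrightarrow> (\<forall>x. count_list xs x \<le> 1)"
proof (induction xs)
  case (Cons a xs)
  then show ?case
    by (auto simp: count_list_0_iff le_Suc_eq)
qed simp

text \<open>In a walk with distinct tail only the initial vertex can recur, and at most once: if it
  does not recur the walk is a path, otherwise a PWIC.\<close>

lemma is_path_or_pwic_iff:
  assumes "a \<noteq> b"
  shows "is_path V E a b w \<or> is_pwic V E a b w \<longleftrightarrow> is_walk V E a b w \<and> distinct (tl w)"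
proof (cases w)
  case (Cons x xs)
  have "distinct (a # xs) \<or> count_list xs a = 1 \<and> (\<forall>x. x \<noteq> a \<longrightarrow> count_list xs x \<le> 1) \<longleftrightarrow> distinct xs"
  proof (cases "a \<in> set xs")
    case True
    then have "count_list xs a \<noteq> 0" by (simp add: count_list_0_iff)
    then have "count_list xs a = 1 \<longleftrightarrow> count_list xs a \<le> 1" by linarith
    with True show ?thesis unfolding distinct_iff_count_list[of xs] by auto
  qed simp
  then show ?thesis
    using assms Cons by (auto simp: is_path_def is_pwic_def is_walk_def)
qed (auto simp: is_path_def is_pwic_def is_walk_def)

lemma paths_pwics_on_self:
  assumes "v r \<in> V"
  shows "paths_pwics_on V E v r r I = (if I = {} then {[v r]} else {})"
proof -
  \<comment> \<open>The rule \<open>remdups_adj.cases\<close> serves only to split lists into empty,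
    singleton and longer ones.\<close>
  have "is_path V E a a w \<longleftrightarrow> w = [a]" if "a \<in> V" for a w
  proof (cases w rule: remdups_adj.cases)
    case (3 x y ys)
    then show ?thesis
      using that by (auto simp: is_path_def is_walk_def split: if_splits)
  qed (use that in \<open>auto simp: is_path_def is_walk_def\<close>)
  with assms show ?thesis
    by (auto simp: paths_pwics_on_def is_pwic_def)
qed

lemma is_walk_eq_Cons: "is_walk V E a b w \<Longrightarrow> w = a # tl w"
  by (cases w) (auto simp: is_walk_def)

text \<open>A PWIC meets its initial vertex again in its tail, so removing \<open>j\<close> from the
  index set leaves only paths. The case \<open>j = r\<close> is included.\<close>

lemma paths_pwics_on_Diff:
  assumes inj: "inj_on v S" and S: "I \<subseteq> S" "j \<in> I"
  shows "paths_pwics_on V E v j r (I - {j}) =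
    {w. is_walk V E (v j) (v r) w \<and> distinct w \<and> set w = v ` I}"
proof -
  have image: "v ` (I - {j}) = v ` I - {v j}"
    using S inj_on_image_set_diff[OF inj, of I "{j}"] by auto
  have no_pwic: "\<not> is_pwic V E (v j) (v r) w" if "set (tl w) = v ` I - {v j}" for w
  proof
    assume w: "is_pwic V E (v j) (v r) w"
    then have "w = v j # tl w" "count_list w (v j) = 2"
      using is_walk_eq_Cons[of V E "v j" "v r" w] by (auto simp: is_pwic_def)
    then have "count_list (tl w) (v j) \<noteq> 0" by (cases w) auto
    then have "v j \<in> set (tl w)" by (simp add: count_list_0_iff)
    with that show False by simp
  qed
  have set_tl: "set (tl w) = v ` I - {v j} \<longleftrightarrow> set w = v ` I"
    if "is_walk V E (v j) (v r) w" "distinct w" for w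
    using is_walk_eq_Cons[OF that(1)] that(2) S by (cases w) auto
  have "(is_path V E (v j) (v r) w \<or> is_pwic V E (v j) (v r) w) \<and> set (tl w) = v ` I - {v j} \<longleftrightarrow>
      is_walk V E (v j) (v r) w \<and> distinct w \<and> set w = v ` I" for w
    using no_pwic[of w] set_tl[of w] unfolding is_path_def by blast
  then show ?thesis
    by (simp only: paths_pwics_on_def image)
qed

text \<open>Without its initial vertex, a path or PWIC becomes a path through exactly the vertices
  indexed by \<open>I\<close>, since a return to \<open>v l\<close> is an ordinary vertex of the
  rest. Conversely, any such path may be prefixed by an adjacent \<open>v l\<close>.\<close>

lemma paths_pwics_on_first_step:
  assumes inj: "inj_on v S" and V: "v ` S = V"
    and l: "l \<in> S" "r \<in> S" "l \<noteq> r" and I: "I \<subseteq> S"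
  shows "paths_pwics_on V E v l r I =
    (\<Union>j\<in>{j\<in>I. {v l, v j} \<in> E}. (#) (v l) ` paths_pwics_on V E v j r (I - {j}))"
    (is "?L = ?R")
proof -
  have ne: "v l \<noteq> v r" using inj l by (auto dest: inj_onD)
  have L: "?L = {w. is_walk V E (v l) (v r) w \<and> distinct (tl w) \<and> set (tl w) = v ` I}"
    unfolding paths_pwics_on_def is_path_or_pwic_iff[OF ne] by auto
  have R: "?R = (\<Union>j\<in>{j\<in>I. {v l, v j} \<in> E}.
      (#) (v l) ` {w. is_walk V E (v j) (v r) w \<and> distinct w \<and> set w = v ` I})"
    using paths_pwics_on_Diff[OF inj I] by auto
  show ?thesis unfolding L R
  proof (intro equalityI subsetI)
    fix w assume "w \<in> {w. is_walk V E (v l) (v r) w \<and> distinct (tl w) \<and> set (tl w) = v ` I}"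
    then have w: "is_walk V E (v l) (v r) w" "distinct (tl w)" "set (tl w) = v ` I" by auto
    show "w \<in> (\<Union>j\<in>{j\<in>I. {v l, v j} \<in> E}.
      (#) (v l) ` {w. is_walk V E (v j) (v r) w \<and> distinct w \<and> set w = v ` I})"
    proof (cases w rule: remdups_adj.cases)
      case (3 x y ys)
      with w(3) obtain j where "j \<in> I" "y = v j" by auto
      with 3 w show ?thesis by (auto simp: is_walk_Cons_Cons)
    qed (use w ne in \<open>auto simp: is_walk_def\<close>)
  next
    fix w assume "w \<in> (\<Union>j\<in>{j\<in>I. {v l, v j} \<in> E}.
      (#) (v l) ` {w. is_walk V E (v j) (v r) w \<and> distinct w \<and> set w = v ` I})"
    then obtain j t where t: "j \<in> I" "{v l, v j} \<in> E" "w = v l # t"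
      "is_walk V E (v j) (v r) t" "distinct t" "set t = v ` I" by auto
    moreover obtain t' where "t = v j # t'" using is_walk_eq_Cons[OF t(4)] by blast
    ultimately show "w \<in> {w. is_walk V E (v l) (v r) w \<and> distinct (tl w) \<and> set (tl w) = v ` I}"
      using l V by (auto simp: is_walk_Cons_Cons)
  qed
qed

lemma finite_paths_pwics_on:
  assumes "finite V"
  shows "finite (paths_pwics_on V E v l r I)"
proof (rule finite_subset)
  show "paths_pwics_on V E v l r I \<subseteq> {w. set w \<subseteq> V \<and> length w \<le> Suc (card V)}"
  proof
    fix w assume "w \<in> paths_pwics_on V E v l r I"
    then have w: "is_walk V E (v l) (v r) w" "distinct (tl w)"
      using is_path_or_pwic_iff[of "v l" "v r" V E w]
      by (auto simp: paths_pwics_on_def is_path_def is_pwic_def distinct_tl)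
    then have "set w \<subseteq> V" by (simp add: is_walk_def)
    moreover have "length (tl w) \<le> card V"
      using distinct_card[OF w(2)] card_mono[OF assms, of "set (tl w)"] \<open>set w \<subseteq> V\<close>
      by (cases w) auto
    ultimately show "w \<in> {w. set w \<subseteq> V \<and> length w \<le> Suc (card V)}" by auto
  qed
  show "finite {w. set w \<subseteq> V \<and> length w \<le> Suc (card V)}"
    by (rule finite_lists_length_le[OF assms])
qed

lemma card_paths_pwics_on_first_step:
  assumes "finite V" and inj: "inj_on v S" and "v ` S = V"
    and "l \<in> S" "r \<in> S" "l \<noteq> r" and I: "I \<subseteq> S"
  shows "card (paths_pwics_on V E v l r I) =
    (\<Sum>j | j \<in> I \<and> {v l, v j} \<in> E. card (paths_pwics_on V E v j r (I - {j})))"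
proof -
  have S: "finite S" using finite_imageD[OF _ inj] assms(1,3) by simp
  \<comment> \<open>Walks from different families differ in their second vertex.\<close>
  have disj: "(#) (v l) ` paths_pwics_on V E v i r (I - {i}) \<inter>
      (#) (v l) ` paths_pwics_on V E v j r (I - {j}) = {}"
    if "i \<in> I" "j \<in> I" "i \<noteq> j" for i j
  proof -
    have "v i \<noteq> v j" using that I inj_onD[OF inj, of i j] by blast
    then show ?thesis
      using that by (auto simp: paths_pwics_on_Diff[OF inj I] is_walk_def)
  qed
  have "card (paths_pwics_on V E v l r I) =
      (\<Sum>j | j \<in> I \<and> {v l, v j} \<in> E. card ((#) (v l) ` paths_pwics_on V E v j r (I - {j})))"
    unfolding paths_pwics_on_first_step[OF assms(2-7)]
  proof (rule card_UN_disjoint)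
    show "finite {j \<in> I. {v l, v j} \<in> E}"
      using finite_subset[OF I S] by simp
  qed (simp_all add: disj finite_paths_pwics_on[OF \<open>finite V\<close>])
  also have "\<dots> = (\<Sum>j | j \<in> I \<and> {v l, v j} \<in> E. card (paths_pwics_on V E v j r (I - {j})))"
    by (intro sum.cong refl card_image) (simp add: inj_on_def)
  finally show ?thesis .
qed

text \<open>The last vertex differs from the first, so it lies in the tail. This is the divisibility
  of \<mu>_l by \<open>zeta {r}\<close> at the level of walks.\<close>

lemma paths_pwics_on_contains_target:
  assumes "paths_pwics_on V E v l r I \<noteq> {}" "inj_on v S" "I \<subseteq> S" "l \<in> S" "r \<in> S" "l \<noteq> r"
  shows "r \<in> I"
proof -
  have ne: "v l \<noteq> v r" using inj_onD[OF assms(2), of l r] assms by blast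
  obtain w where w: "is_walk V E (v l) (v r) w" "set (tl w) = v ` I"
    using assms(1) by (auto simp: paths_pwics_on_def is_path_def is_pwic_def)
  obtain t where t: "w = v l # t" using is_walk_eq_Cons[OF w(1)] by blast
  with w ne have "v r \<in> v ` I"
    by (auto simp: is_walk_def split: if_splits dest: last_in_set)
  then show ?thesis using inj_on_image_mem_iff[OF assms(2,5,3)] by blast
qed

section \<open>The eigenvector\<close>

text \<open>For \<open>l = r\<close> only the trivial path counts, and its weight is \<open>1\<close>.\<close>

definition path_coeff ::
  "'a set \<Rightarrow> 'a set set \<Rightarrow> (nat \<Rightarrow> 'a) \<Rightarrow> (nat \<Rightarrow> complex) \<Rightarrow> nat \<Rightarrow> nat \<Rightarrow> nat set \<Rightarrow> complex" where
  "path_coeff V E v g r l I =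
     path_pwic_gamma V E v l r I * (if l = r then 1 else inverse (g l)) * (\<Prod>j\<in>I - {r}. inverse (g j))"

text \<open>The first-step count with weights: this is the coefficient of \<open>zeta I\<close> in
  the linear recursion for \<mu>_l.\<close>

lemma path_coeff_recursion:
  assumes V: "finite V" and inj: "inj_on v S" and vS: "v ` S = V"
    and l: "l \<in> S" and r: "r \<in> S" and lr: "l \<noteq> r" and I: "I \<subseteq> S" and g: "g l \<noteq> 0"
  shows "g l * path_coeff V E v g r l I =
    - (\<Sum>j | j \<in> I \<and> {v l, v j} \<in> E. path_coeff V E v g r j (I - {j}))"
proof -
  have "finite S" using finite_imageD[OF _ inj] V vS by simp
  then have fI: "finite I" using I finite_subset by blast
  let ?N = "\<lambda>j J. of_nat (card (paths_pwics_on V E v j r J)) :: complex"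
  let ?P = "\<Prod>i\<in>I - {r}. inverse (g i)"
  \<comment> \<open>Passing from \<open>I\<close> to \<open>I - {j}\<close> flips the sign. For
    \<open>j \<noteq> r\<close> the factor of \<open>j\<close> missing from the product returns as
    the prefactor of the walks from \<open>v j\<close>; for \<open>j = r\<close> neither is present.
    Hence the weight is the same for all \<open>j\<close>.\<close>
  have step: "path_coeff V E v g r j (I - {j}) = - ((-1) ^ card I * ?P * ?N j (I - {j}))"
    if j: "j \<in> I" for j
  proof -
    have sign: "(-1) ^ card I = - ((-1) ^ card (I - {j}) :: complex)"
      using j fI by (metis card_Suc_Diff1 minus_one_mult_self mult_minus1 power_Suc)
    show ?thesis
    proof (cases "j = r")
      case False
      then have "?P = inverse (g j) * (\<Prod>i\<in>I - {r} - {j}. inverse (g i))"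
        using j fI by (intro prod.remove) auto
      moreover have "I - {r} - {j} = I - {j} - {r}" by blast
      ultimately show ?thesis
        using False by (simp add: path_coeff_def path_pwic_gamma_def sign)
    next
      case True
      then show ?thesis
        by (simp add: path_coeff_def path_pwic_gamma_def flip: sign) (simp add: sign)
    qed
  qed
  have "g l * path_coeff V E v g r l I = (-1) ^ card I * ?P * ?N l I"
    using g lr by (simp add: path_coeff_def path_pwic_gamma_def)
  also have "\<dots> = (\<Sum>j | j \<in> I \<and> {v l, v j} \<in> E. (-1) ^ card I * ?P * ?N j (I - {j}))"
    by (simp add: card_paths_pwics_on_first_step[OF V inj vS l r lr I] sum_distrib_left)
  also have "\<dots> = - (\<Sum>j | j \<in> I \<and> {v l, v j} \<in> E. path_coeff V E v g r j (I - {j}))"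
    by (simp add: step sum_negf)
  finally show ?thesis .
qed

lemma zeon_laplacian_carrier: "zeon_laplacian m v E \<in> carrier_mat m m"
  by (auto simp: zeon_laplacian_def nilpotent_adjacency_def intro!: minus_carrier_mat)

lemma zeon_laplacian_index:
  assumes "i < m" "j < m"
  shows "zeon_laplacian m v E $$ (i, j) =
    (if i = j then of_nat (vdegree E (v (Suc i))) else 0) -
    (if {v (Suc i), v (Suc j)} \<in> E then zeta {Suc j} else 0)"
  using assms by (simp add: zeon_laplacian_def nilpotent_adjacency_def degree_matrix_def mat_diag_def)

lemma scalar_part_zeon_laplacian:
  assumes "i < m" "j < m"
  shows "scalar_part (zeon_laplacian m v E $$ (i, j)) =
    (if i = j then of_nat (vdegree E (v (Suc i))) else 0)"
  using assms by (simp add: zeon_laplacian_index)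

lemma zeon_laplacian_mult_vec:
  assumes "l \<in> {1..m}"
  shows "(zeon_laplacian m v E *\<^sub>v vec m (\<lambda>i. \<mu> (Suc i))) $ (l - 1) =
    of_nat (vdegree E (v l)) * \<mu> l - (\<Sum>j | j \<in> {1..m} \<and> {v l, v j} \<in> E. zeta {j} * \<mu> j)"
proof -
  have l: "l - 1 < m" "Suc (l - 1) = l" using assms by auto
  let ?a = "\<lambda>j. (if l = j then of_nat (vdegree E (v l)) * \<mu> l else 0) -
      (if {v l, v j} \<in> E then zeta {j} * \<mu> j else 0)"
  have "(zeon_laplacian m v E *\<^sub>v vec m (\<lambda>i. \<mu> (Suc i))) $ (l - 1) =
      (\<Sum>j<m. zeon_laplacian m v E $$ (l - 1, j) * \<mu> (Suc j))"
    using zeon_laplacian_carrier[of m v E] l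
    by (simp add: scalar_prod_def atLeast0LessThan)
  also have "\<dots> = (\<Sum>j<m. ?a (Suc j))"
    using l by (intro sum.cong) (auto simp: zeon_laplacian_index left_diff_distrib)
  also have "\<dots> = (\<Sum>j\<in>{1..m}. ?a j)"
    by (rule sum.reindex_bij_witness[of _ "\<lambda>j. j - 1" Suc]) auto
  also have "\<dots> = of_nat (vdegree E (v l)) * \<mu> l -
      (\<Sum>j\<in>{1..m}. if {v l, v j} \<in> E then zeta {j} * \<mu> j else 0)"
    using assms by (simp add: sum_subtractf)
  also have "(\<Sum>j\<in>{1..m}. if {v l, v j} \<in> E then zeta {j} * \<mu> j else 0) =
      (\<Sum>j | j \<in> {1..m} \<and> {v l, v j} \<in> E. zeta {j} * \<mu> j)"
    by (subst sum.inter_filter[symmetric]) simp_all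
  finally show ?thesis .
qed

theorem theorem3p12:
  fixes V :: "'a set" and E :: "'a set set" and m :: nat and v :: "nat \<Rightarrow> 'a"
    and d :: int and r :: nat
  assumes graph: "simple_graph V E"
    and enum: "bij_betw v {1..m} V"
    and r: "r \<in> {1..m}"
    and deg_r: "int (vdegree E (v r)) = d"
    and uniq: "\<forall>i\<in>{1..m}. int (vdegree E (v i)) = d \<longrightarrow> i = r"
  shows "(\<exists>!lam. zeon_eigenvalue (zeon_laplacian m v E) lam \<and> scalar_part lam = of_int d) \<and>
    (\<forall>lam. zeon_eigenvalue (zeon_laplacian m v E) lam \<and> scalar_part lam = of_int d \<longrightarrow>
      (\<exists>\<mu> :: nat \<Rightarrow> zeon.
        zeon_eigenvector (zeon_laplacian m v E) (vec m (\<lambda>i. \<mu> (Suc i))) lam \<and>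
        \<mu> r = 1 \<and>
        (\<forall>i\<in>{1..m} - {r}. \<mu> i \<in> zeon_nilpotents m) \<and>
        (\<forall>l\<in>{1..m} - {r}. \<forall>I. I \<subseteq> {1..m} \<longrightarrow>
          zcoeff (\<mu> l) I =
            path_pwic_gamma V E v l r I * inverse (of_int d - of_nat (vdegree E (v l))) *
            (\<Prod>j\<in>I - {r}. inverse (of_int d - of_nat (vdegree E (v j))))) \<and>
        lam = of_int d - (\<Sum>j | j \<in> {1..m} \<and> {v j, v r} \<in> E. zeta {j} * \<mu> j)))"
proof -
  let ?A = "zeon_laplacian m v E"
  have V: "finite V" and inj: "inj_on v {1..m}" and vS: "v ` {1..m} = V"
    using graph enum by (auto simp: simple_graph_def bij_betw_def)
  define g :: "nat \<Rightarrow> complex" where "g l = of_int d - of_nat (vdegree E (v l))" for l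
  have g: "g l \<noteq> 0" if l: "l \<in> {1..m}" "l \<noteq> r" for l
  proof
    assume "g l = 0"
    then have "of_int (int (vdegree E (v l))) = (of_int d :: complex)" by (simp add: g_def)
    then have "int (vdegree E (v l)) = d" by (simp only: of_int_eq_iff)
    with uniq l show False by blast
  qed
  define c where "c = path_coeff V E v g r"
  define \<mu> where "\<mu> l = (\<Sum>I\<in>Pow {1..m}. zscalar (c l I) * zeta I)" for l
  define N where "N = (\<Sum>j | j \<in> {1..m} \<and> {v j, v r} \<in> E. zeta {j} * \<mu> j)"
  \<comment> \<open>Since the Laplacian is \<open>Delta - Psi\<close>, row \<open>r\<close> applied
    to a vector with \<open>\<mu> r = 1\<close> gives \<open>d - N\<close>. With
    \<open>d + N\<close> this row would hold only if \<open>N = 0\<close>.\<close>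
  define lam where "lam = of_int d - N"
  have coeff: "zcoeff (\<mu> l) I = (if I \<subseteq> {1..m} then c l I else 0)" for l I
    unfolding \<mu>_def by (rule zcoeff_sum_zeta) auto
  have \<mu>r: "\<mu> r = 1"
  proof (rule zeon_eqI)
    have "v r \<in> V" using r vS by blast
    then show "zcoeff (\<mu> r) I = zcoeff 1 I" for I
      by (simp add: coeff one_zeon.rep_eq c_def path_coeff_def path_pwic_gamma_def paths_pwics_on_self)
  qed
  have supp: "r \<in> I" if "l \<in> {1..m}" "l \<noteq> r" "zcoeff (\<mu> l) I \<noteq> 0" for l I
  proof -
    have "I \<subseteq> {1..m}" "paths_pwics_on V E v l r I \<noteq> {}"
      using that by (auto simp: coeff c_def path_coeff_def path_pwic_gamma_def split: if_splits)
    then show ?thesis using paths_pwics_on_contains_target[OF _ inj] that r by blast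
  qed
  have no_loop: "{v r, v r} \<notin> E"
    using graph by (auto simp: simple_graph_def)
  have N_supp: "r \<in> I" if "zcoeff N I \<noteq> 0" for I
  proof -
    from that obtain j where j: "j \<in> {1..m}" "{v j, v r} \<in> E" "zcoeff (zeta {j} * \<mu> j) I \<noteq> 0"
      unfolding N_def zcoeff_sum by (metis (mono_tags, lifting) mem_Collect_eq sum.not_neutral_contains_not_neutral)
    \<comment> \<open>The entry \<open>\<mu> r = 1\<close> is not a multiple of
      \<open>zeta {r}\<close>; the absence of loops keeps it out of \<open>N\<close>.\<close>
    then have "j \<noteq> r" using no_loop by auto
    obtain J where "J \<subseteq> I" "zcoeff (\<mu> j) (I - J) \<noteq> 0"
      using j(3) by (rule zcoeff_mult_nonzeroE)
    with supp[OF j(1) \<open>j \<noteq> r\<close>] show ?thesis by blast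
  qed
  have nil: "scalar_part (\<mu> l) = 0" if "l \<in> {1..m}" "l \<noteq> r" for l
    using supp[OF that, of "{}"] by (auto simp: scalar_part_def)
  have rec: "of_int d * \<mu> l - of_nat (vdegree E (v l)) * \<mu> l =
      - (\<Sum>j | j \<in> {1..m} \<and> {v l, v j} \<in> E. zeta {j} * \<mu> j)"
    if l: "l \<in> {1..m}" "l \<noteq> r" for l
  proof (rule zeon_eqI)
    fix I :: "nat set" assume I: "finite I"
    have "zcoeff (\<Sum>j | j \<in> {1..m} \<and> {v l, v j} \<in> E. zeta {j} * \<mu> j) I =
        (\<Sum>j | j \<in> {1..m} \<and> {v l, v j} \<in> E. if j \<in> I then zcoeff (\<mu> j) (I - {j}) else 0)"
      unfolding zcoeff_sum by (intro sum.cong refl zcoeff_zeta_singleton_mult I) auto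
    also have "\<dots> = (\<Sum>j | j \<in> {1..m} \<and> {v l, v j} \<in> E \<and> j \<in> I. zcoeff (\<mu> j) (I - {j}))"
      by (subst sum.inter_filter[symmetric]) (auto intro: sum.cong)
    \<comment> \<open>For \<open>I\<close> not inside \<open>{1..m}\<close> both sides vanish, as
      removing an element of \<open>{1..m}\<close> does not bring \<open>I\<close> inside.\<close>
    also have "\<dots> = - (g l * zcoeff (\<mu> l) I)"
    proof (cases "I \<subseteq> {1..m}")
      case True
      then have "{j. j \<in> {1..m} \<and> {v l, v j} \<in> E \<and> j \<in> I} = {j. j \<in> I \<and> {v l, v j} \<in> E}"
        by auto
      moreover have "I - {j} \<subseteq> {1..m}" for j using True by blast
      ultimately show ?thesis
        using path_coeff_recursion[OF V inj vS l(1) r l(2) True, of g E, OF g[OF l]] True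
        by (simp add: coeff c_def)
    next
      case False
      then have "\<not> I - {j} \<subseteq> {1..m}" if "j \<in> {1..m}" for j using that by blast
      with False show ?thesis by (simp add: coeff)
    qed
    finally show "zcoeff (of_int d * \<mu> l - of_nat (vdegree E (v l)) * \<mu> l) I =
        zcoeff (- (\<Sum>j | j \<in> {1..m} \<and> {v l, v j} \<in> E. zeta {j} * \<mu> j)) I"
      by (simp add: zcoeff_of_int_mult zcoeff_of_nat_mult g_def left_diff_distrib)
  qed
  have row: "(?A *\<^sub>v vec m (\<lambda>i. \<mu> (Suc i))) $ (l - 1) = lam * \<mu> l" if l: "l \<in> {1..m}" for l
  proof (cases "l = r")
    case True
    have "of_nat (vdegree E (v r)) = (of_int d :: zeon)"
      using deg_r by (metis of_int_of_nat_eq)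
    then show ?thesis
      unfolding zeon_laplacian_mult_vec[OF l]
      by (simp add: True \<mu>r lam_def N_def insert_commute)
  next
    case False
    have "N * \<mu> l = 0"
      using N_supp supp[OF l False] by (rule zeon_mult_eq_0I)
    then show ?thesis
      unfolding zeon_laplacian_mult_vec[OF l] using rec[OF l False]
      by (simp add: lam_def algebra_simps)
  qed
  have ev: "zeon_eigenvector ?A (vec m (\<lambda>i. \<mu> (Suc i))) lam"
    unfolding zeon_eigenvector_def scalar_part_conjugate_scalar_prod
  proof (intro conjI)
    show "\<exists>i<dim_vec (vec m (\<lambda>i. \<mu> (Suc i))). scalar_part (vec m (\<lambda>i. \<mu> (Suc i)) $ i) \<noteq> 0"
      using r \<mu>r by (intro exI[of _ "r - 1"]) auto
    show "?A *\<^sub>v vec m (\<lambda>i. \<mu> (Suc i)) = lam \<cdot>\<^sub>v vec m (\<lambda>i. \<mu> (Suc i))"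
    proof (rule eq_vecI)
      fix i assume "i < dim_vec (lam \<cdot>\<^sub>v vec m (\<lambda>i. \<mu> (Suc i)))"
      then show "(?A *\<^sub>v vec m (\<lambda>i. \<mu> (Suc i))) $ i = (lam \<cdot>\<^sub>v vec m (\<lambda>i. \<mu> (Suc i))) $ i"
        using row[of "Suc i"] by simp
    qed (use zeon_laplacian_carrier[of m v E] in simp)
  qed (use zeon_laplacian_carrier[of m v E] in auto)
  have lam_d: "scalar_part lam = of_int d"
    by (simp add: lam_def N_def scalar_part_sum)
  have unique: "lam' = lam" if "zeon_eigenvalue ?A lam'" "scalar_part lam' = of_int d" for lam'
  \<comment> \<open>Vertex \<open>r\<close> corresponds to row \<open>r - 1\<close>, as matrix
    indices start at \<open>0\<close>.\<close>
  proof (rule zeon_eigenvalue_unique[OF zeon_laplacian_carrier[of m v E], where k = "r - 1"])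
    show "r - 1 < m" using r by auto
    show "zeon_eigenvalue ?A lam" using ev zeon_eigenvalue_def by blast
    show "scalar_part (?A $$ (l, l)) \<noteq> of_int d" if "l < m" "l \<noteq> r - 1" for l
    proof -
      have "Suc l \<in> {1..m}" "Suc l \<noteq> r" using that r by auto
      from g[OF this] show ?thesis
        using that(1) by (simp add: scalar_part_zeon_laplacian g_def)
    qed
  qed (use that lam_d in \<open>auto simp: scalar_part_zeon_laplacian\<close>)
  have sub: "\<mu> l \<in> zeon_subalgebra m" for l
    unfolding \<mu>_def
    by (intro sum_in_zeon_subalgebra zeon_subalgebra.mult zeon_subalgebra.scalar zeta_in_zeon_subalgebra) auto
  show ?thesis
  proof (intro conjI allI impI)
    show "\<exists>!lam. zeon_eigenvalue ?A lam \<and> scalar_part lam = of_int d"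
      using ev lam_d unique by (auto simp: zeon_eigenvalue_def intro!: ex1I[of _ lam])
  next
    fix lam' assume "zeon_eigenvalue ?A lam' \<and> scalar_part lam' = of_int d"
    then have [simp]: "lam' = lam" using unique by blast
    show "\<exists>\<mu> :: nat \<Rightarrow> zeon.
        zeon_eigenvector ?A (vec m (\<lambda>i. \<mu> (Suc i))) lam' \<and>
        \<mu> r = 1 \<and>
        (\<forall>i\<in>{1..m} - {r}. \<mu> i \<in> zeon_nilpotents m) \<and>
        (\<forall>l\<in>{1..m} - {r}. \<forall>I. I \<subseteq> {1..m} \<longrightarrow>
          zcoeff (\<mu> l) I =
            path_pwic_gamma V E v l r I * inverse (of_int d - of_nat (vdegree E (v l))) *
            (\<Prod>j\<in>I - {r}. inverse (of_int d - of_nat (vdegree E (v j))))) \<and>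
        lam' = of_int d - (\<Sum>j | j \<in> {1..m} \<and> {v j, v r} \<in> E. zeta {j} * \<mu> j)"
      using ev \<mu>r sub nil
      by (intro exI[of _ \<mu>])
         (auto simp: zeon_nilpotents_eq coeff c_def path_coeff_def g_def lam_def N_def)
  qed
qed

end
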